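(* Let $r, d$ be positive integers and let $\mathcal{F}$ be a family of $(r-1)\left(\frac{d(d+3)}{2}+1\right)+1$ ellipsoids of volume one in $\mathbb{R}^d$. Then there exists a partition of $\mathcal{F}$ into $r$ parts $\mathcal{A}_1, \ldots, \mathcal{A}_r$ such that $\bigcap_{j=1}^r \operatorname{conv}\left(\bigcup \mathcal{A}_j\right)$ contains an ellipsoid of volume one.
   Context: An ellipsoid in $\mathbb{R}^d$ is the image of the Euclidean unit ball under an invertible affine map. $\operatorname{conv}$ is the convex hull and $\bigcup \mathcal{A}_j$ the union of the sets in $\mathcal{A}_j$. *)

theory Defs
  imports "HOL-Analysis.Analysis" "HOL-Library.Disjoint_Sets"
begin

definition ellipsoid :: "(real ^ 'n) set \<Rightarrow> bool" where
  "ellipsoid K \<longleftrightarrow>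
    (\<exists>(M :: real ^ 'n ^ 'n) (c :: real ^ 'n). invertible M \<and> K = (\<lambda>x. M *v x + c) ` cball 0 1)"

end

theory Submission
  imports Defs
begin

text \<open>
  By Gram-Schmidt every ellipsoid is \<open>L B + c\<close> with \<open>B\<close> the unit ball and \<open>L\<close> lower triangular with
  positive diagonal, so ellipsoids are points \<open>(L, c)\<close> of a space of dimension \<open>d (d + 3) / 2\<close>, and
  Tverberg's theorem there yields a partition and a common point \<open>(C, c)\<close> of the hulls of its parts.
  A convex combination of the maps \<open>y \<mapsto> L y + c\<close> sends \<open>B\<close> into the convex hull of the union of the
  ellipsoids, and \<open>det\<close> is a product of diagonal entries on triangular matrices, so concavity of
  \<open>ln\<close> bounds the volume of \<open>C B + c\<close> from below by one; shrinking gives volume exactly one.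

  Tverberg's theorem is proved by minimising, over all partitions, all points \<open>y j\<close> in the hulls of
  the parts and all \<open>w\<close>, the sum of the squared distances from \<open>w\<close> to the \<open>y j\<close>. Since there are
  more points than equations, the weights can be perturbed along a dependence common to all parts
  until the sum decreases or some point becomes superfluous; a superfluous point can be moved to
  another part so that the sum decreases.
\<close>

section \<open>Tverberg's theorem\<close>

text \<open>Gaussian elimination, by induction on the equations: a nonzero coefficient of the new
  equation is a pivot that removes one unknown together with that equation.\<close>

lemma underdetermined_system_nontrivial_solution:
  fixes f :: "'k \<Rightarrow> 'i \<Rightarrow> real"
  assumes "finite K" "finite I" "card K < card I"
  shows "\<exists>\<mu>. (\<exists>i\<in>I. \<mu> i \<noteq> 0) \<and> (\<forall>k\<in>K. (\<Sum>i\<in>I. f k i * \<mu> i) = 0)"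
  using assms
proof (induction K arbitrary: I f rule: finite_induct)
  case empty
  then have "I \<noteq> {}" by auto
  then show ?case by (intro exI[of _ "\<lambda>_. 1"]) auto
next
  case (insert k K)
  show ?case
  proof (cases "\<forall>i\<in>I. f k i = 0")
    case True
    then show ?thesis
      using insert.IH[of I f] insert.prems insert.hyps by auto
  next
    case False
    then obtain p where p: "p \<in> I" "f k p \<noteq> 0" by blast
    define f' where "f' l i = f l i - f l p * f k i / f k p" for l i
    have "card K < card (I - {p})"
      using insert.prems insert.hyps p by (simp add: card_Diff_singleton)
    then obtain \<mu> where \<mu>: "\<exists>i\<in>I - {p}. \<mu> i \<noteq> 0"
        "\<forall>l\<in>K. (\<Sum>i\<in>I - {p}. f' l i * \<mu> i) = 0"
      using insert.IH[of "I - {p}" f'] insert.prems by auto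
    define s where "s = (\<Sum>i\<in>I - {p}. f k i * \<mu> i)"
    \<comment> \<open>The value at \<open>p\<close> is the one that solves equation \<open>k\<close>
      once the other unknowns are fixed.\<close>
    define \<nu> where "\<nu> = \<mu>(p := - s / f k p)"
    have split: "(\<Sum>i\<in>I. f l i * \<nu> i) = (\<Sum>i\<in>I - {p}. f l i * \<mu> i) - f l p * s / f k p" for l
    proof -
      have "(\<Sum>i\<in>I - {p}. f l i * \<nu> i) = (\<Sum>i\<in>I - {p}. f l i * \<mu> i)"
        by (rule sum.cong) (auto simp: \<nu>_def)
      then show ?thesis
        using insert.prems p by (simp add: sum.remove[of I p] \<nu>_def)
    qed
    have "(\<Sum>i\<in>I - {p}. f' l i * \<mu> i) = (\<Sum>i\<in>I. f l i * \<nu> i)" for l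
      unfolding split s_def f'_def
      by (simp add: algebra_simps sum_subtractf sum_distrib_left sum_divide_distrib)
    then have "\<forall>l\<in>K. (\<Sum>i\<in>I. f l i * \<nu> i) = 0" using \<mu>(2) by simp
    moreover have "(\<Sum>i\<in>I. f k i * \<nu> i) = 0"
      unfolding split using p by (simp add: s_def)
    moreover have "\<exists>i\<in>I. \<nu> i \<noteq> 0" using \<mu>(1) by (auto simp: \<nu>_def)
    ultimately show ?thesis by auto
  qed
qed

text \<open>Weights sit on indices rather than on points, so \<open>x\<close> may repeat values and
  weights can later be perturbed index by index.\<close>

lemma convex_hull_image_finite:
  fixes x :: "'i \<Rightarrow> 'v::real_vector"
  assumes "finite A"
  shows "convex hull (x ` A) =
    {\<Sum>i\<in>A. u i *\<^sub>R x i | u. (\<forall>i\<in>A. 0 \<le> u i) \<and> sum u A = 1}" (is "_ = ?R")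
proof
  have "convex ?R"
  proof (rule convexI, clarify)
    fix s t :: real and u v :: "'i \<Rightarrow> real"
    assume h: "0 \<le> s" "0 \<le> t" "s + t = 1" "\<forall>i\<in>A. 0 \<le> u i" "sum u A = 1" "\<forall>i\<in>A. 0 \<le> v i" "sum v A = 1"
    show "\<exists>w. s *\<^sub>R (\<Sum>i\<in>A. u i *\<^sub>R x i) + t *\<^sub>R (\<Sum>i\<in>A. v i *\<^sub>R x i) = (\<Sum>i\<in>A. w i *\<^sub>R x i) \<and>
        (\<forall>i\<in>A. 0 \<le> w i) \<and> sum w A = 1"
      using h by (intro exI[of _ "\<lambda>i. s * u i + t * v i"])
        (simp add: scaleR_right.sum scaleR_left_distrib sum.distrib sum_distrib_left[symmetric])
  qed
  moreover have "x ` A \<subseteq> ?R"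
  proof clarify
    fix p assume "p \<in> A"
    then show "\<exists>u. x p = (\<Sum>i\<in>A. u i *\<^sub>R x i) \<and> (\<forall>i\<in>A. 0 \<le> u i) \<and> sum u A = 1"
      using assms by (intro exI[of _ "\<lambda>i. if i = p then 1 else 0"])
        (auto simp: if_distrib[of "\<lambda>c. c *\<^sub>R _"] cong: if_cong)
  qed
  ultimately show "convex hull (x ` A) \<subseteq> ?R" by (rule hull_minimal[rotated])
next
  show "?R \<subseteq> convex hull (x ` A)"
    by clarify (rule convex_sum[OF assms convex_convex_hull], auto intro: hull_inc)
qed

text \<open>The parallel axis identity: deviations from the centroid \<open>c\<close> sum to zero,
  which kills the cross terms. It makes \<open>c\<close> the only minimiser over
  \<open>w\<close>.\<close>

lemma sum_norm_diff_squared_mean: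
  fixes y :: "'j \<Rightarrow> 'v::real_inner"
  assumes "finite J" "J \<noteq> {}" and c: "c = (1 / card J) *\<^sub>R sum y J"
  shows "(\<Sum>j\<in>J. (norm (w - y j))\<^sup>2) = (\<Sum>j\<in>J. (norm (c - y j))\<^sup>2) + card J * (norm (w - c))\<^sup>2"
proof -
  have "card J *\<^sub>R c = sum y J" using assms by simp
  then have z: "(\<Sum>j\<in>J. c - y j) = 0" by (simp add: sum_subtractf sum_constant_scaleR)
  have "(norm (w - y j))\<^sup>2 = (norm (c - y j))\<^sup>2 + (norm (w - c))\<^sup>2 + 2 * ((w - c) \<bullet> (c - y j))" for j
    by (simp add: power2_norm_eq_inner algebra_simps inner_commute)
  then show ?thesis
    using z by (simp add: sum.distrib sum_distrib_left[symmetric] inner_sum_right[symmetric])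
qed

lemma norm_diff_decreases_towards:
  fixes w y p :: "'v::real_inner"
  assumes "(w - y) \<bullet> (p - y) > 0"
  obtains t where "0 < t" "t \<le> 1" "(norm (w - (y + t *\<^sub>R (p - y))))\<^sup>2 < (norm (w - y))\<^sup>2"
proof -
  define n where "n = (norm (p - y))\<^sup>2"
  define s where "s = (w - y) \<bullet> (p - y)"
  have "p \<noteq> y" using assms by auto
  then have n: "n > 0" by (simp add: n_def)
  have s: "s > 0" using assms by (simp add: s_def)
  \<comment> \<open>\<open>s / n\<close> is the vertex of the parabola describing the squared
    distance; the cap at 1 keeps the point on the segment.\<close>
  define t where "t = min 1 (s / n)"
  have t: "0 < t" "t \<le> 1" "t * n \<le> s" using n s by (auto simp: t_def min_def field_simps)
  have "(norm (w - (y + t *\<^sub>R (p - y))))\<^sup>2 = (norm (w - y))\<^sup>2 - 2 * t * s + t * (t * n)"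
    unfolding s_def n_def
    by (simp add: power2_norm_eq_inner algebra_simps inner_commute)
  also have "t * (t * n) \<le> t * s" using t by (intro mult_left_mono) auto
  also have "(norm (w - y))\<^sup>2 - 2 * t * s + t * s < (norm (w - y))\<^sup>2" using t s by simp
  finally show thesis using t that by simp
qed

text \<open>An assignment \<open>a\<close> encodes a partition, so covering and disjointness come
  for free; the hull condition makes every part nonempty, the hull of the empty set being
  empty.\<close>

definition tverberg_config ::
    "'i set \<Rightarrow> 'j set \<Rightarrow> ('i \<Rightarrow> 'v::real_vector) \<Rightarrow> ('i \<Rightarrow> 'j) \<Rightarrow> ('j \<Rightarrow> 'v) \<Rightarrow> bool" where
  "tverberg_config I J x a y \<longleftrightarrow>
    a \<in> I \<rightarrow> J \<and> (\<forall>j\<in>J. y j \<in> convex hull (x ` {i \<in> I. a i = j}))"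

definition spread :: "'j set \<Rightarrow> ('j \<Rightarrow> 'v::real_inner) \<Rightarrow> 'v \<Rightarrow> real" where
  "spread J y w = (\<Sum>j\<in>J. (norm (w - y j))\<^sup>2)"

text \<open>Compactness gives a best \<open>w\<close> for each assignment, and finitely many
  assignments compete. The bound \<open>card J \<le> card I\<close> allows all parts to be
  nonempty.\<close>

lemma tverberg_config_minimum_exists:
  fixes x :: "'i \<Rightarrow> 'v::euclidean_space" and J :: "'j set"
  assumes "finite I" "finite J" "J \<noteq> {}" "card J \<le> card I"
  obtains a y w where "tverberg_config I J x a y"
    and "\<And>a' y' w'. tverberg_config I J x a' y' \<Longrightarrow> spread J y w \<le> spread J y' w'"
proof -
  define P where "P a j = convex hull (x ` {i \<in> I. a i = j})" for a :: "'i \<Rightarrow> 'j" and j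
  \<comment> \<open>Extensional functions make this set finite. Surjectivity matters:
    \<open>infdist\<close> to an empty hull would be 0 and give a false minimum.\<close>
  define \<A> where "\<A> = {a \<in> I \<rightarrow>\<^sub>E J. a ` I = J}"
  define f where "f a w = (\<Sum>j\<in>J. (infdist w (P a j))\<^sup>2)" for a w
  define C where "C = convex hull (x ` I)"
  have "finite \<A>"
    unfolding \<A>_def using assms by (intro finite_subset[OF _ finite_PiE[of I "\<lambda>_. J"]]) auto
  obtain g where g: "g ` J \<subseteq> I" "inj_on g J"
    using card_le_inj[OF assms(2,1,4)] by blast
  obtain j0 where "j0 \<in> J" using assms by blast
  \<comment> \<open>One point \<open>g j\<close> is reserved for each part and all others go to
    \<open>j0\<close>, so a surjective assignment exists.\<close>
  define a0 where "a0 i = (if i \<in> I then if i \<in> g ` J then the_inv_into J g i else j0 else undefined)" for i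
  have "a0 ` I = J"
  proof
    show "a0 ` I \<subseteq> J"
      using g \<open>j0 \<in> J\<close> by (auto simp: a0_def the_inv_into_f_f)
    show "J \<subseteq> a0 ` I"
    proof
      fix j assume "j \<in> J"
      then have "a0 (g j) = j" "g j \<in> I" using g by (auto simp: a0_def the_inv_into_f_f)
      then show "j \<in> a0 ` I" by (metis imageI)
    qed
  qed
  then have "a0 \<in> \<A>" by (auto simp: \<A>_def PiE_iff extensional_def) (simp add: a0_def)
  have "I \<noteq> {}" using \<open>a0 ` I = J\<close> assms by auto
  have P: "compact (P a j)" for a j
    unfolding P_def using assms by (intro compact_convex_hull finite_imp_compact) auto
  have "compact C" "C \<noteq> {}"
    unfolding C_def using assms \<open>I \<noteq> {}\<close> by (auto intro: compact_convex_hull finite_imp_compact)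
  have "\<exists>w\<in>C. \<forall>v\<in>C. f a w \<le> f a v" for a
    unfolding f_def
    by (intro continuous_attains_inf \<open>compact C\<close> \<open>C \<noteq> {}\<close> continuous_intros)
  then obtain W where W: "\<And>a. W a \<in> C" "\<And>a v. v \<in> C \<Longrightarrow> f a (W a) \<le> f a v" by metis
  obtain a where a: "a \<in> \<A>" "\<And>a'. a' \<in> \<A> \<Longrightarrow> f a (W a) \<le> f a' (W a')"
    using ex_is_arg_min_if_finite[OF \<open>finite \<A>\<close>, of "\<lambda>a. f a (W a)"] \<open>a0 \<in> \<A>\<close>
    by (auto simp: is_arg_min_linorder)
  define y where "y j = closest_point (P a j) (W a)" for j
  have ne: "P a j \<noteq> {}" if "j \<in> J" for j
    using a(1) that by (auto simp: P_def \<A>_def)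
  have y: "y j \<in> P a j" "infdist (W a) (P a j) = norm (W a - y j)" if "j \<in> J" for j
  proof -
    show *: "y j \<in> P a j"
      unfolding y_def by (intro closest_point_in_set compact_imp_closed P ne that)
    have "norm (W a - y j) \<le> dist (W a) z" if "z \<in> P a j" for z
      using closest_point_le[OF compact_imp_closed[OF P] that, of "W a"] by (simp add: y_def dist_norm)
    then have "norm (W a - y j) \<le> infdist (W a) (P a j)"
      using ne[OF that] by (simp add: infdist_def cINF_greatest)
    then show "infdist (W a) (P a j) = norm (W a - y j)"
      using infdist_le[OF *, of "W a"] by (simp add: dist_norm)
  qed
  have cfg: "tverberg_config I J x a y"
    using a(1) y(1) by (auto simp: tverberg_config_def \<A>_def P_def)
  have val: "spread J y (W a) = f a (W a)"
    unfolding spread_def f_def by (rule sum.cong) (auto simp: y)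
  have "spread J y (W a) \<le> spread J y' w'" if c: "tverberg_config I J x a' y'" for a' y' w'
  proof -
    define b where "b = restrict a' I"
    have Pb: "P b j = convex hull (x ` {i \<in> I. a' i = j})" for j
    proof -
      have "{i \<in> I. b i = j} = {i \<in> I. a' i = j}" by (auto simp: b_def)
      then show ?thesis by (simp add: P_def)
    qed
    have yP: "y' j \<in> P b j" if "j \<in> J" for j
      using c that unfolding Pb tverberg_config_def by auto
    have "J \<subseteq> b ` I"
    proof
      fix j assume "j \<in> J"
      then have "P b j \<noteq> {}" using yP by auto
      then show "j \<in> b ` I" by (auto simp: P_def)
    qed
    then have "b \<in> \<A>" using c by (auto simp: \<A>_def b_def tverberg_config_def)
    \<comment> \<open>The competing \<open>w'\<close> may lie outside \<open>C\<close>, where the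
      choice of \<open>W\<close> says nothing; the centroid \<open>m\<close> lies in
      \<open>C\<close> and does at least as well.\<close>
    define m where "m = (1 / card J) *\<^sub>R sum y' J"
    have "P b j \<subseteq> C" for j
      unfolding P_def C_def by (rule hull_mono) auto
    then have "(\<Sum>j\<in>J. (1 / card J) *\<^sub>R y' j) \<in> C"
      using assms yP by (intro convex_sum) (auto simp: C_def)
    then have "m \<in> C" by (simp add: m_def scaleR_right.sum)
    have "f a (W a) \<le> f b (W b)" using a(2) \<open>b \<in> \<A>\<close> by blast
    also have "\<dots> \<le> f b m" using W(2) \<open>m \<in> C\<close> by blast
    also have "\<dots> \<le> spread J y' m"
      unfolding f_def spread_def
      by (intro sum_mono power_mono) (use yP infdist_le in \<open>auto simp: dist_norm[symmetric] infdist_nonneg\<close>)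
    also have "\<dots> \<le> spread J y' w'"
      using sum_norm_diff_squared_mean[OF assms(2,3) m_def, of w'] by (simp add: spread_def)
    finally show ?thesis using val by simp
  qed
  then show thesis using that cfg by blast
qed

text \<open>
  When \<open>w\<close> is the centroid of the \<open>y j\<close>, the numbers \<open>(w - y j) \<bullet> (x p - y j)\<close> add up to the
  spread, so some \<open>y j\<close> comes closer to \<open>w\<close> by moving towards \<open>x p\<close>.
\<close>

lemma tverberg_config_decrease_by_unused_point:
  fixes x :: "'i \<Rightarrow> 'v::euclidean_space"
  assumes "finite J" "p \<in> I" "a \<in> I \<rightarrow> J"
    and y: "\<And>j. j \<in> J \<Longrightarrow> y j \<in> convex hull (x ` ({i \<in> I. a i = j} - {p}))"
    and w: "(\<Sum>j\<in>J. w - y j) = 0" and pos: "spread J y w > 0"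
  obtains a' y' where "tverberg_config I J x a' y'" "spread J y' w < spread J y w"
proof -
  have "(w - y j) \<bullet> (x p - y j) = (norm (w - y j))\<^sup>2 + (w - y j) \<bullet> (x p - w)" for j
    by (simp add: power2_norm_eq_inner algebra_simps)
  then have "(\<Sum>j\<in>J. (w - y j) \<bullet> (x p - y j)) = spread J y w"
    using w by (simp add: sum.distrib spread_def inner_sum_left[symmetric])
  then have "\<not> (\<forall>j\<in>J. (w - y j) \<bullet> (x p - y j) \<le> 0)"
    using pos sum_nonpos[of J "\<lambda>j. (w - y j) \<bullet> (x p - y j)"] by auto
  then obtain k where k: "k \<in> J" "(w - y k) \<bullet> (x p - y k) > 0"
    by force
  obtain t where t: "0 < t" "t \<le> 1" "(norm (w - (y k + t *\<^sub>R (x p - y k))))\<^sup>2 < (norm (w - y k))\<^sup>2"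
    using norm_diff_decreases_towards[OF k(2)] by blast
  \<comment> \<open>The point \<open>p\<close> joins part \<open>k\<close>; leaving its old part
    does no harm, since every \<open>y j\<close> is a combination of points other than
    \<open>p\<close>.\<close>
  define a' where "a' = a(p := k)"
  define y' where "y' = y(k := y k + t *\<^sub>R (x p - y k))"
  have sub: "convex hull (x ` ({i \<in> I. a i = j} - {p})) \<subseteq> convex hull (x ` {i \<in> I. a' i = j})" for j
    by (rule hull_mono) (auto simp: a'_def)
  have "y' j \<in> convex hull (x ` {i \<in> I. a' i = j})" if "j \<in> J" for j
  proof (cases "j = k")
    case False
    then show ?thesis using y[OF that] sub[of j] by (auto simp: y'_def)
  next
    case True
    have "x p \<in> convex hull (x ` {i \<in> I. a' i = k})"
      using assms(2) by (intro hull_inc) (auto simp: a'_def)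
    moreover have "y k \<in> convex hull (x ` {i \<in> I. a' i = k})"
      using y[OF k(1)] sub[of k] by auto
    ultimately have "(1 - t) *\<^sub>R y k + t *\<^sub>R x p \<in> convex hull (x ` {i \<in> I. a' i = k})"
      using t by (intro convexD[OF convex_convex_hull]) auto
    then show ?thesis using True by (simp add: y'_def algebra_simps)
  qed
  then have "tverberg_config I J x a' y'"
    using assms(3) k(1) by (auto simp: tverberg_config_def a'_def)
  moreover have "spread J y' w < spread J y w"
  proof -
    have "norm (w - (y k + t *\<^sub>R (x p - y k))) \<le> norm (w - y k)"
      using t(3) by (rule power2_le_imp_le[OF less_imp_le]) simp
    then show ?thesis
      unfolding spread_def using t(3) k(1) assms(1)
      by (intro sum_strict_mono_ex1) (auto simp: y'_def intro!: bexI[of _ k])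
  qed
  ultimately show thesis using that by blast
qed

text \<open>Comparing every other part with a fixed part \<open>k\<close> costs one equation for the
  weight sum and one per dimension, fewer in total than the unknown weights.\<close>

lemma exists_common_affine_dependence:
  fixes x :: "'i \<Rightarrow> 'v::euclidean_space"
  assumes "finite I" "finite J" "J \<noteq> {}"
    and card: "(card J - 1) * (dim (x ` I) + 1) < card I"
  obtains \<mu> s m where "\<exists>i\<in>I. \<mu> i < (0::real)"
    and "\<And>j. j \<in> J \<Longrightarrow> (\<Sum>i | i \<in> I \<and> a i = j. \<mu> i) = s"
    and "\<And>j. j \<in> J \<Longrightarrow> (\<Sum>i | i \<in> I \<and> a i = j. \<mu> i *\<^sub>R x i) = m"
proof -
  obtain k where k: "k \<in> J" using assms by blast
  obtain B where B: "x ` I \<subseteq> span B" "card B = dim (x ` I)" "finite B"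
    using basis_exists[of "x ` I"] finiteI_independent by metis
  \<comment> \<open>\<open>None\<close> labels the equation for the weight sums,
    \<open>Some b\<close> the one for the inner products with \<open>b\<close>.\<close>
  define K where "K = (J - {k}) \<times> (insert None (Some ` B))"
  define sg where "sg j i = (if a i = j then 1 else 0) - (if a i = k then 1 else (0::real))" for j i
  define f where "f = (\<lambda>(j, c) i. sg j i * (case c of None \<Rightarrow> 1 | Some b \<Rightarrow> x i \<bullet> b))"
  have "card (insert None (Some ` B)) = dim (x ` I) + 1"
    using B by (subst card_insert_disjoint) (auto simp: card_image)
  then have "card K < card I" "finite K"
    using card k B assms unfolding K_def by (auto simp: card_cartesian_product)
  then obtain \<mu>0 where \<mu>0: "\<exists>i\<in>I. \<mu>0 i \<noteq> 0" "\<And>l. l \<in> K \<Longrightarrow> (\<Sum>i\<in>I. f l i * \<mu>0 i) = 0"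
    using underdetermined_system_nontrivial_solution[of K I f] assms by blast
  \<comment> \<open>A nontrivial solution without negative entries has a positive one, so its
    negation has a negative entry.\<close>
  define \<mu> where "\<mu> = (if \<exists>i\<in>I. \<mu>0 i < 0 then \<mu>0 else (\<lambda>i. - \<mu>0 i))"
  have neg: "\<exists>i\<in>I. \<mu> i < 0"
    using \<mu>0(1) by (auto simp: \<mu>_def) (meson linorder_neqE_linordered_idom)
  have eq: "(\<Sum>i\<in>I. f l i * \<mu> i) = 0" if "l \<in> K" for l
    using \<mu>0(2)[OF that] by (auto simp: \<mu>_def sum_negf)
  have diff: "(\<Sum>i\<in>I. sg j i * g i) = (\<Sum>i | i \<in> I \<and> a i = j. g i) - (\<Sum>i | i \<in> I \<and> a i = k. g i)"
    for j g
  proof -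
    have "sg j i * g i = (if a i = j then g i else 0) - (if a i = k then g i else 0)" for i
      by (simp add: sg_def)
    then show ?thesis
      using assms(1) by (simp add: sum_subtractf sum.If_cases Int_def)
  qed
  have 1: "(\<Sum>i | i \<in> I \<and> a i = j. \<mu> i) = (\<Sum>i | i \<in> I \<and> a i = k. \<mu> i)" if "j \<in> J" for j
  proof (cases "j = k")
    case False
    then show ?thesis
      using eq[of "(j, None)"] diff[of j \<mu>] that by (simp add: K_def f_def)
  qed simp
  have 2: "(\<Sum>i | i \<in> I \<and> a i = j. \<mu> i *\<^sub>R x i) = (\<Sum>i | i \<in> I \<and> a i = k. \<mu> i *\<^sub>R x i)"
    if "j \<in> J" for j
  proof (cases "j = k")
    case False
    define v where "v = (\<Sum>i | i \<in> I \<and> a i = j. \<mu> i *\<^sub>R x i) - (\<Sum>i | i \<in> I \<and> a i = k. \<mu> i *\<^sub>R x i)"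
    \<comment> \<open>A vector of \<open>span B\<close> orthogonal to every \<open>b\<close> is
      orthogonal to itself, so testing against \<open>B\<close> suffices.\<close>
    have "v \<in> span B"
      unfolding v_def using B(1) by (intro span_diff span_sum span_scale) auto
    moreover have "orthogonal v b" if "b \<in> B" for b
      using eq[of "(j, Some b)"] diff[of j "\<lambda>i. \<mu> i * (x i \<bullet> b)"] that False \<open>j \<in> J\<close>
      by (simp add: K_def f_def v_def orthogonal_def inner_diff_left inner_sum_left mult_ac)
    ultimately have "orthogonal v v" by (rule orthogonal_to_span)
    then show ?thesis by (simp add: orthogonal_self v_def)
  qed simp
  show thesis using that[OF neg] 1 2 by blast
qed

text \<open>If the minimum were positive, every weight would be positive, as otherwise a point could
  be moved to another part. This leaves room to perturb the weights along a common dependence,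
  whatever its weight sum \<open>s\<close>.\<close>

lemma tverberg_config_minimum_is_zero:
  fixes x :: "'i \<Rightarrow> 'v::euclidean_space" and J :: "'j set"
  assumes fin: "finite I" "finite J" "J \<noteq> {}"
    and card: "(card J - 1) * (dim (x ` I) + 1) < card I"
    and cfg: "tverberg_config I J x a y"
    and min: "\<And>a' y' w'. tverberg_config I J x a' y' \<Longrightarrow> spread J y w \<le> spread J y' w'"
  shows "spread J y w = 0"
proof (rule ccontr)
  assume "spread J y w \<noteq> 0"
  moreover have "spread J y w \<ge> 0" by (simp add: spread_def sum_nonneg)
  ultimately have pos: "spread J y w > 0" by simp
  have aIJ: "a \<in> I \<rightarrow> J" using cfg by (simp add: tverberg_config_def)
  \<comment> \<open>With the \<open>y j\<close> kept fixed, minimality in \<open>w\<close> forces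
    \<open>w\<close> to be the centroid.\<close>
  define c where "c = (1 / card J) *\<^sub>R sum y J"
  have "card J * (norm (w - c))\<^sup>2 \<le> 0"
    using min[OF cfg, of c] sum_norm_diff_squared_mean[OF fin(2,3) c_def, of w] by (simp add: spread_def)
  then have "w = c" using fin by (simp add: mult_le_0_iff card_eq_0_iff)
  then have "card J *\<^sub>R w = sum y J" using fin by (simp add: c_def)
  then have w: "(\<Sum>j\<in>J. w - y j) = 0" by (simp add: sum_subtractf sum_constant_scaleR)
  have no_unused: False
    if "p \<in> I" "\<And>j. j \<in> J \<Longrightarrow> y' j \<in> convex hull (x ` ({i \<in> I. a i = j} - {p}))"
      "(\<Sum>j\<in>J. w' - y' j) = 0" "spread J y' w' = spread J y w" for p y' w'
  proof (rule tverberg_config_decrease_by_unused_point[OF fin(2) that(1) aIJ that(2,3)])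
    show "spread J y' w' > 0" using that(4) pos by simp
    show False if "tverberg_config I J x a'' y''" "spread J y'' w' < spread J y' w'" for a'' y''
      using min[OF that(1), of w'] that(2) \<open>spread J y' w' = spread J y w\<close> by simp
  qed

  have "\<forall>j\<in>J. \<exists>u. y j = (\<Sum>i | i \<in> I \<and> a i = j. u i *\<^sub>R x i) \<and> (\<forall>i\<in>{i \<in> I. a i = j}. 0 \<le> u i) \<and>
      sum u {i \<in> I. a i = j} = 1"
    using cfg fin unfolding tverberg_config_def by (simp add: convex_hull_image_finite)
  from bchoice[OF this] obtain u where u: "\<And>j. j \<in> J \<Longrightarrow> y j = (\<Sum>i | i \<in> I \<and> a i = j. u j i *\<^sub>R x i)"
      "\<And>j i. j \<in> J \<Longrightarrow> i \<in> I \<Longrightarrow> a i = j \<Longrightarrow> 0 \<le> u j i" "\<And>j. j \<in> J \<Longrightarrow> sum (u j) {i \<in> I. a i = j} = 1"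
    by blast
  \<comment> \<open>Each index lies in exactly one part, so the weights of all parts merge into a
    single function.\<close>
  define \<kappa> where "\<kappa> i = u (a i) i" for i
  have \<kappa>: "\<And>j. j \<in> J \<Longrightarrow> y j = (\<Sum>i | i \<in> I \<and> a i = j. \<kappa> i *\<^sub>R x i)"
      "\<And>i. i \<in> I \<Longrightarrow> 0 \<le> \<kappa> i" "\<And>j. j \<in> J \<Longrightarrow> (\<Sum>i | i \<in> I \<and> a i = j. \<kappa> i) = 1"
    using u funcset_mem[OF aIJ] by (auto simp: \<kappa>_def intro!: sum.cong)
  have hull_without: "(\<Sum>i | i \<in> I \<and> a i = j. \<nu> i *\<^sub>R x i) \<in> convex hull (x ` ({i \<in> I. a i = j} - {p}))"
    if "j \<in> J" "\<And>i. i \<in> I \<Longrightarrow> 0 \<le> \<nu> i" "(\<Sum>i | i \<in> I \<and> a i = j. \<nu> i) = 1" "\<nu> p = 0" for \<nu> p j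
  proof -
    let ?A = "{i \<in> I. a i = j}"
    have "sum \<nu> ?A = sum \<nu> (?A - {p})" "(\<Sum>i\<in>?A. \<nu> i *\<^sub>R x i) = (\<Sum>i\<in>?A - {p}. \<nu> i *\<^sub>R x i)"
      using fin that(4) by (auto intro!: sum.mono_neutral_right)
    then show ?thesis using that fin by (auto simp: convex_hull_image_finite)
  qed
  have \<kappa>_pos: "\<kappa> i > 0" if "i \<in> I" for i
  proof (rule ccontr)
    assume "\<not> \<kappa> i > 0"
    then have "\<kappa> i = 0" using \<kappa>(2)[OF that] by simp
    then have "y j \<in> convex hull (x ` ({i \<in> I. a i = j} - {i}))" if "j \<in> J" for j
      using hull_without[of j \<kappa> i] \<kappa> that by simp
    then show False using no_unused[OF that _ w] by simp
  qed

  obtain \<mu> s m where \<mu>: "\<exists>i\<in>I. \<mu> i < (0::real)"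
      "\<And>j. j \<in> J \<Longrightarrow> (\<Sum>i | i \<in> I \<and> a i = j. \<mu> i) = s"
      "\<And>j. j \<in> J \<Longrightarrow> (\<Sum>i | i \<in> I \<and> a i = j. \<mu> i *\<^sub>R x i) = m"
    using exists_common_affine_dependence[OF fin card, where a = a] by blast
  show False
  proof (cases "s = 0")
    case True
    \<comment> \<open>Adding a multiple of \<open>\<mu>\<close> to the weights translates every \<open>y j\<close> by the same vector, so the
      spread is kept while some weight can be driven to zero.\<close>
    define N where "N = {i \<in> I. \<mu> i < 0}"
    have "finite N" "N \<noteq> {}" using fin \<mu>(1) by (auto simp: N_def)
    \<comment> \<open>A ratio test: among the decreasing weights, that of \<open>p\<close> reaches
      zero first.\<close>
    then obtain p where p: "p \<in> N" "\<And>i. i \<in> N \<Longrightarrow> \<kappa> p / - \<mu> p \<le> \<kappa> i / - \<mu> i"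
      using ex_is_arg_min_if_finite[of N "\<lambda>i. \<kappa> i / - \<mu> i"] by (auto simp: is_arg_min_linorder)
    define t where "t = \<kappa> p / - \<mu> p"
    have p': "p \<in> I" "\<mu> p < 0" using p by (auto simp: N_def)
    then have "t > 0" using \<kappa>_pos[of p] by (simp add: t_def divide_pos_neg)
    define \<nu> where "\<nu> i = \<kappa> i + t * \<mu> i" for i
    have "\<nu> p = 0" using p' by (simp add: \<nu>_def t_def)
    have nonneg: "0 \<le> \<nu> i" if "i \<in> I" for i
    proof (cases "\<mu> i < 0")
      case True
      then have "t \<le> \<kappa> i / - \<mu> i" using p(2)[of i] that by (simp add: N_def t_def)
      then show ?thesis using True by (simp add: \<nu>_def field_simps)
    next
      case False
      then show ?thesis using \<kappa>(2)[OF that] \<open>t > 0\<close> by (simp add: \<nu>_def)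
    qed
    have sum1: "(\<Sum>i | i \<in> I \<and> a i = j. \<nu> i) = 1" if "j \<in> J" for j
      using \<kappa>(3) \<mu>(2) that True by (simp add: \<nu>_def sum.distrib sum_distrib_left[symmetric])
    have sum2: "(\<Sum>i | i \<in> I \<and> a i = j. \<nu> i *\<^sub>R x i) = y j + t *\<^sub>R m" if "j \<in> J" for j
    proof -
      have "(\<Sum>i | i \<in> I \<and> a i = j. \<nu> i *\<^sub>R x i) =
          (\<Sum>i | i \<in> I \<and> a i = j. \<kappa> i *\<^sub>R x i) + t *\<^sub>R (\<Sum>i | i \<in> I \<and> a i = j. \<mu> i *\<^sub>R x i)"
        by (simp add: \<nu>_def scaleR_left_distrib sum.distrib scaleR_right.sum)
      then show ?thesis using \<kappa>(1) \<mu>(3) that by simp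
    qed
    show False
    proof (rule no_unused[OF p'(1)])
      show "y j + t *\<^sub>R m \<in> convex hull (x ` ({i \<in> I. a i = j} - {p}))" if "j \<in> J" for j
        using hull_without[OF that nonneg sum1[OF that] \<open>\<nu> p = 0\<close>] sum2[OF that] by simp
      show "(\<Sum>j\<in>J. (w + t *\<^sub>R m) - (y j + t *\<^sub>R m)) = 0" using w by simp
      show "spread J (\<lambda>j. y j + t *\<^sub>R m) (w + t *\<^sub>R m) = spread J y w" by (simp add: spread_def)
    qed
  next
    case False
    \<comment> \<open>Now \<open>m / s\<close> lies in the affine hull of every part, and contracting towards it shrinks the spread.\<close>
    define q where "q i = \<kappa> i / (\<kappa> i + \<bar>\<mu> i / s\<bar>)" for i
    have "I \<noteq> {}" using \<mu>(1) by auto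
    then obtain p where p: "p \<in> I" "\<And>i. i \<in> I \<Longrightarrow> q p \<le> q i"
      using ex_is_arg_min_if_finite[OF fin(1), of q] by (auto simp: is_arg_min_linorder)
    \<comment> \<open>The bound \<open>t \<le> q i\<close> keeps \<open>\<nu> i\<close> nonnegative
      even if \<open>\<mu> i / s\<close> is negative; halving gives \<open>t < 1\<close>.\<close>
    define t where "t = q p / 2"
    have "\<kappa> p + \<bar>\<mu> p / s\<bar> > 0" using \<kappa>_pos[OF p(1)] by (intro add_pos_nonneg) auto
    then have "0 < q p" "q p \<le> 1"
      using \<kappa>_pos[OF p(1)] by (auto simp: q_def pos_divide_le_eq simp del: abs_divide)
    then have t: "0 < t" "t < 1" by (auto simp: t_def)
    define \<nu> where "\<nu> i = (1 - t) * \<kappa> i + t * (\<mu> i / s)" for i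
    have nonneg: "0 \<le> \<nu> i" if "i \<in> I" for i
    proof -
      have "t \<le> q i" using p(2)[OF that] t by (simp add: t_def)
      moreover have "\<kappa> i + \<bar>\<mu> i / s\<bar> > 0" using \<kappa>_pos[OF that] by (intro add_pos_nonneg) auto
      ultimately have "t * (\<kappa> i + \<bar>\<mu> i / s\<bar>) \<le> \<kappa> i" by (simp add: q_def pos_le_divide_eq)
      moreover have "t * (- (\<mu> i / s)) \<le> t * \<bar>\<mu> i / s\<bar>" using t by (intro mult_left_mono abs_ge_minus_self) auto
      ultimately show ?thesis unfolding \<nu>_def by (simp add: algebra_simps)
    qed
    have sum1: "(\<Sum>i | i \<in> I \<and> a i = j. \<nu> i) = 1" if "j \<in> J" for j
    proof -
      have "(\<Sum>i | i \<in> I \<and> a i = j. \<nu> i) =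
          (1 - t) * (\<Sum>i | i \<in> I \<and> a i = j. \<kappa> i) + t * ((\<Sum>i | i \<in> I \<and> a i = j. \<mu> i) / s)"
        by (simp add: \<nu>_def sum.distrib sum_distrib_left sum_divide_distrib)
      then show ?thesis using \<kappa>(3)[OF that] \<mu>(2)[OF that] False by simp
    qed
    have sum2: "(\<Sum>i | i \<in> I \<and> a i = j. \<nu> i *\<^sub>R x i) = (1 - t) *\<^sub>R y j + (t / s) *\<^sub>R m" if "j \<in> J" for j
    proof -
      have "(\<Sum>i | i \<in> I \<and> a i = j. \<nu> i *\<^sub>R x i) =
          (1 - t) *\<^sub>R (\<Sum>i | i \<in> I \<and> a i = j. \<kappa> i *\<^sub>R x i) + (t / s) *\<^sub>R (\<Sum>i | i \<in> I \<and> a i = j. \<mu> i *\<^sub>R x i)"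
        by (simp add: \<nu>_def scaleR_left_distrib sum.distrib scaleR_right.sum)
      then show ?thesis using \<kappa>(1) \<mu>(3) that by simp
    qed
    define y' where "y' j = (1 - t) *\<^sub>R y j + (t / s) *\<^sub>R m" for j
    define w' where "w' = (1 - t) *\<^sub>R w + (t / s) *\<^sub>R m"
    have "y' j \<in> convex hull (x ` {i \<in> I. a i = j})" if "j \<in> J" for j
      unfolding y'_def sum2[OF that, symmetric]
      using nonneg sum1[OF that] fin by (auto simp: convex_hull_image_finite)
    then have "spread J y w \<le> spread J y' w'"
      using min[of a y' w'] aIJ by (simp add: tverberg_config_def)
    also have "\<dots> = (1 - t)\<^sup>2 * spread J y w"
    proof -
      have "w' - y' j = (1 - t) *\<^sub>R (w - y j)" for j by (simp add: w'_def y'_def algebra_simps)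
      then show ?thesis by (simp add: spread_def power_mult_distrib sum_distrib_left)
    qed
    also have "\<dots> < 1 * spread J y w"
      using t pos by (intro mult_strict_right_mono) (auto simp: power_less_one_iff)
    finally show False by simp
  qed
qed

text \<open>The bound involves the linear dimension of the points and not that of the ambient type,
  so triangular matrices can stay inside the space of all square matrices.\<close>

theorem tverberg:
  fixes x :: "'i \<Rightarrow> 'v::euclidean_space" and J :: "'j set"
  assumes "finite I" "finite J" "J \<noteq> {}"
    and card: "(card J - 1) * (dim (x ` I) + 1) < card I"
  obtains A z where "(\<Union>j\<in>J. A j) = I" "disjoint_family_on A J"
    "\<And>j. j \<in> J \<Longrightarrow> z \<in> convex hull (x ` A j)"
proof -
  have "card J - 1 \<le> (card J - 1) * (dim (x ` I) + 1)" by simp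
  then have "card J \<le> card I" using card by linarith
  then obtain a y w where cfg: "tverberg_config I J x a y"
    and min: "\<And>a' y' w'. tverberg_config I J x a' y' \<Longrightarrow> spread J y w \<le> spread J y' w'"
    using tverberg_config_minimum_exists[OF assms(1-3), of x] by metis
  have "spread J y w = 0"
    using tverberg_config_minimum_is_zero[OF assms cfg min] .
  then have "\<And>j. j \<in> J \<Longrightarrow> y j = w"
    using assms(2) by (auto simp: spread_def sum_nonneg_eq_0_iff)
  then have "\<And>j. j \<in> J \<Longrightarrow> w \<in> convex hull (x ` {i \<in> I. a i = j})"
    using cfg by (auto simp: tverberg_config_def)
  moreover have "(\<Union>j\<in>J. {i \<in> I. a i = j}) = I" "disjoint_family_on (\<lambda>j. {i \<in> I. a i = j}) J"
    using cfg by (auto simp: tverberg_config_def disjoint_family_on_def)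
  ultimately show thesis using that by blast
qed

section \<open>Relabelling coordinates\<close>

text \<open>
  The library computes the measure of a linear image only for vectors whose index type is a
  well-order; a well-ordered copy of an arbitrary finite index type makes it applicable.
\<close>

typedef 'a well_ordered = "UNIV :: 'a set" by simp

instance well_ordered :: (finite) finite
proof
  have "(UNIV :: 'a well_ordered set) = range Abs_well_ordered"
    by (metis Rep_well_ordered_inverse rangeI subset_antisym subset_UNIV subsetI)
  then show "finite (UNIV :: 'a well_ordered set)"
    by (metis finite finite_imageI)
qed

instantiation well_ordered :: (finite) wellorder
begin

definition "x \<le> y \<longleftrightarrow> to_nat (Rep_well_ordered x) \<le> to_nat (Rep_well_ordered y)"

definition "x < y \<longleftrightarrow> to_nat (Rep_well_ordered x) < to_nat (Rep_well_ordered y)"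

instance
proof
  fix x y :: "'a well_ordered"
  assume "x \<le> y" "y \<le> x"
  then show "x = y"
    by (simp add: less_eq_well_ordered_def Rep_well_ordered_inject)
next
  fix P :: "'a well_ordered \<Rightarrow> bool" and x
  assume step: "\<And>x. (\<And>y. y < x \<Longrightarrow> P y) \<Longrightarrow> P x"
  show "P x"
    by (induction x rule: measure_induct_rule[where f = "\<lambda>x. to_nat (Rep_well_ordered x)"])
      (rule step, simp add: less_well_ordered_def)
qed (auto simp: less_eq_well_ordered_def less_well_ordered_def)

end

lemma bij_Rep_well_ordered: "bij Rep_well_ordered"
  by (rule o_bij[of Abs_well_ordered])
    (auto simp: fun_eq_iff Rep_well_ordered_inverse Abs_well_ordered_inverse)

definition relabel :: "('m \<Rightarrow> 'n) \<Rightarrow> real ^ 'n \<Rightarrow> real ^ 'm" where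
  "relabel \<phi> v = (\<chi> k. v $ \<phi> k)"

lemma linear_relabel: "linear (relabel \<phi>)"
  by (rule linearI) (auto simp: relabel_def vec_eq_iff)

lemma relabel_inverse:
  assumes "bij \<phi>"
  shows "relabel \<phi> (relabel (inv \<phi>) v) = v" "relabel (inv \<phi>) (relabel \<phi> w) = w"
  using assms
  by (auto simp: relabel_def vec_eq_iff bij_is_inj bij_is_surj inv_f_f surj_f_inv_f)

lemma norm_relabel:
  assumes "bij \<phi>"
  shows "norm (relabel \<phi> v) = norm v"
  unfolding norm_vec_def L2_set_def relabel_def
  using sum.reindex_bij_betw[of \<phi> UNIV UNIV "\<lambda>i. (norm (v $ i))\<^sup>2"] assms by simp

lemma relabel_image_cball:
  assumes "bij \<phi>"
  shows "relabel \<phi> ` cball 0 r = cball 0 r"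
proof
  show "cball 0 r \<subseteq> relabel \<phi> ` cball 0 r"
  proof
    fix v :: "real ^ 'a"
    assume "v \<in> cball 0 r"
    then have "relabel (inv \<phi>) v \<in> cball 0 r"
      using assms by (simp add: norm_relabel bij_imp_bij_inv)
    then show "v \<in> relabel \<phi> ` cball 0 r"
      by (metis image_eqI relabel_inverse(1)[OF assms])
  qed
qed (auto simp: norm_relabel[OF assms])

section \<open>Lebesgue measure under relabelling of coordinates\<close>

lemma prod_Basis_vec: "(\<Prod>b\<in>Basis. (v :: real ^ 'n) \<bullet> b) = (\<Prod>i\<in>UNIV. v $ i)"
proof -
  have Basis: "(Basis :: (real ^ 'n) set) = range (\<lambda>i. axis i 1)"
    by (auto simp: Basis_vec_def)
  have "inj (\<lambda>i. axis i 1 :: real ^ 'n)"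
    by (auto simp: inj_on_def axis_eq_axis)
  then show ?thesis
    unfolding Basis by (subst prod.reindex) (auto simp: inner_axis)
qed

text \<open>Lebesgue measure is determined by its values on boxes, and a relabelling only permutes
  the sides of a box.\<close>

lemma lborel_distr_relabel:
  assumes "bij \<phi>"
  shows "distr lborel borel (relabel \<phi>) = lborel"
proof (rule lborel_eqI[symmetric])
  fix l u :: "real ^ 'a"
  assume "\<And>b. b \<in> Basis \<Longrightarrow> l \<bullet> b \<le> u \<bullet> b"
  then have le: "l $ i \<le> u $ i" for i
    by (metis axis_in_Basis_iff inner_axis inner_real_def mult.right_neutral Basis_real_def singletonI)
  define l' u' where "l' = relabel (inv \<phi>) l" and "u' = relabel (inv \<phi>) u"
  have lu: "l' $ \<phi> k = l $ k" "u' $ \<phi> k = u $ k" for k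
    using assms by (auto simp: l'_def u'_def relabel_def bij_is_inj)
  have all: "(\<forall>i. R i) \<longleftrightarrow> (\<forall>k. R (\<phi> k))" for R
    using assms by (metis bij_pointE)
  have pre: "relabel \<phi> -` box l u = box l' u'"
  proof (rule set_eqI)
    fix v
    show "v \<in> relabel \<phi> -` box l u \<longleftrightarrow> v \<in> box l' u'"
      using all[of "\<lambda>i. l' $ i < v $ i \<and> v $ i < u' $ i"] by (simp add: mem_box_cart relabel_def lu)
  qed
  have le': "l' $ i \<le> u' $ i" for i
    using all[of "\<lambda>i. l' $ i \<le> u' $ i"] le lu by simp
  have "emeasure (distr lborel borel (relabel \<phi>)) (box l u) = emeasure lborel (box l' u')"
    using pre linear_continuous_on[OF linear_conv_bounded_linear[THEN iffD1, OF linear_relabel[of \<phi>]]]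
    by (subst emeasure_distr) (auto intro: borel_measurable_continuous_onI)
  also have "\<dots> = ennreal (\<Prod>b\<in>Basis. (u' - l') \<bullet> b)"
    using le' by (intro emeasure_lborel_box) (auto simp: Basis_vec_def inner_axis)
  also have "\<dots> = ennreal (\<Prod>b\<in>Basis. (u - l) \<bullet> b)"
    unfolding prod_Basis_vec
    using prod.reindex_bij_betw[of \<phi> UNIV UNIV "\<lambda>i. (u' - l') $ i"] assms by (simp add: lu)
  finally show "emeasure (distr lborel borel (relabel \<phi>)) (box l u) = (\<Prod>b\<in>Basis. (u - l) \<bullet> b)" .
qed simp

text \<open>Compactness makes \<open>S\<close> and its image Borel sets, on which
  \<open>lebesgue\<close> and \<open>lborel\<close> agree and the pushforward can be
  evaluated.\<close>

lemma measure_relabel_image: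
  assumes "bij \<phi>" "compact S"
  shows "measure lebesgue (relabel \<phi> ` S) = measure lebesgue S"
proof -
  have cont: "continuous_on A (relabel \<phi>)" for A
    by (simp add: linear_continuous_on linear_conv_bounded_linear[symmetric] linear_relabel)
  have "compact (relabel \<phi> ` S)" using assms cont by (intro compact_continuous_image)
  then have b: "relabel \<phi> ` S \<in> sets borel" by (intro borel_compact)
  have "measure lebesgue (relabel \<phi> ` S) = measure (distr lborel borel (relabel \<phi>)) (relabel \<phi> ` S)"
    using b by (simp add: lborel_distr_relabel[OF assms(1)])
  also have "\<dots> = measure lborel (relabel \<phi> -` relabel \<phi> ` S)"
    using b cont by (subst measure_distr) (auto intro: borel_measurable_continuous_onI)
  also have "relabel \<phi> -` relabel \<phi> ` S = S"
    by (rule inj_vimage_image_eq) (metis injI relabel_inverse(2)[OF assms(1)])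
  finally show ?thesis using borel_compact[OF assms(2)] by simp
qed

text \<open>The new matrix is the old one conjugated by the relabelling, which carries unit ball to
  unit ball.\<close>

lemma ellipsoid_relabel_image:
  fixes \<phi> :: "'m::finite \<Rightarrow> 'n::finite"
  assumes "bij \<phi>" "ellipsoid K"
  shows "ellipsoid (relabel \<phi> ` K)"
proof -
  obtain M :: "real ^ 'n ^ 'n" and c where M: "invertible M" "K = (\<lambda>x. M *v x + c) ` cball 0 1"
    using assms(2) unfolding ellipsoid_def by blast
  define f where "f = (\<lambda>x. relabel \<phi> (M *v relabel (inv \<phi>) x))"
  have "linear f"
    using linear_compose[OF linear_compose[OF linear_relabel[of "inv \<phi>"] matrix_vector_mul_linear[of M]] linear_relabel[of \<phi>]]
    by (simp add: f_def o_def)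
  then have f: "matrix f *v x = f x" for x by (metis matrix_vector_mul(2))
  have bij_relabel: "bij (relabel \<psi>)" if "bij \<psi>" for \<psi> :: "'x::finite \<Rightarrow> 'y::finite"
    by (rule o_bij[of "relabel (inv \<psi>)"]) (auto simp: fun_eq_iff relabel_inverse[OF that])
  have "bij f"
    using bij_comp[OF bij_comp[OF bij_relabel[OF bij_imp_bij_inv[OF assms(1)]] M(1)[unfolded invertible_eq_bij]] bij_relabel[OF assms(1)]]
    by (simp add: f_def o_def)
  moreover have "(*v) (matrix f) = f" using f by auto
  ultimately have "invertible (matrix f)"
    by (simp add: invertible_eq_bij)
  moreover have "relabel \<phi> ` K = (\<lambda>x. matrix f *v x + relabel \<phi> c) ` cball 0 1"
  proof -
    have "relabel \<phi> ` K = (\<lambda>x. relabel \<phi> (M *v x) + relabel \<phi> c) ` relabel (inv \<phi>) ` cball 0 1"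
      unfolding M(2) relabel_image_cball[OF bij_imp_bij_inv[OF assms(1)]] image_image
      by (simp add: linear_add[OF linear_relabel])
    then show ?thesis unfolding f by (simp add: image_image f_def)
  qed
  ultimately show ?thesis unfolding ellipsoid_def by blast
qed

lemma compact_ellipsoid:
  assumes "ellipsoid K"
  shows "compact K"
proof -
  obtain M :: "real ^ 'a ^ 'a" and c where "K = (\<lambda>x. M *v x + c) ` cball 0 1"
    using assms unfolding ellipsoid_def by blast
  moreover have "continuous_on (cball 0 1) (\<lambda>x. M *v x + c)"
    by (intro continuous_on_add matrix_vector_mult_linear_continuous_on continuous_on_const)
  ultimately show ?thesis
    by (simp add: compact_continuous_image)
qed

section \<open>Ellipsoids in triangular form\<close>

text \<open>These matrices form a convex set on which the determinant is positive, so convex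
  combinations of them still define ellipsoids.\<close>

definition lower_triangular_pos :: "real ^ 'n::{finite,wellorder} ^ 'n::_ \<Rightarrow> bool" where
  "lower_triangular_pos L \<longleftrightarrow> (\<forall>i j. i < j \<longrightarrow> L $ i $ j = 0) \<and> (\<forall>i. L $ i $ i > 0)"

lemma det_lower_triangular_pos:
  assumes "lower_triangular_pos L"
  shows "det L = (\<Prod>i\<in>UNIV. L $ i $ i)" "det L > 0"
proof -
  show "det L = (\<Prod>i\<in>UNIV. L $ i $ i)"
    using assms by (intro det_lowerdiagonal) (auto simp: lower_triangular_pos_def)
  then show "det L > 0"
    using assms by (auto simp: lower_triangular_pos_def intro: prod_pos)
qed

lemma matrix_matrix_mult_component:
  fixes A :: "real ^ 'n ^ 'm" and B :: "real ^ 'k ^ 'n"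
  shows "(A ** B) $ i $ j = row i A \<bullet> column j B"
  by (simp add: matrix_matrix_mult_def inner_vec_def row_def column_def)

text \<open>Gram-Schmidt applied to the rows of \<open>M\<close>: the rows of \<open>Q\<close> are
  the orthonormal vectors, and \<open>L\<close> holds the coordinates of the rows of
  \<open>M\<close> in them.\<close>

lemma LQ_decomposition:
  fixes M :: "real ^ 'n::{finite,wellorder} ^ 'n::_"
  assumes "invertible M"
  obtains L Q where "lower_triangular_pos L" "orthogonal_matrix Q" "M = L ** Q"
proof -
  define v where "v i = row i M" for i
  obtain N where N: "M ** N = mat 1"
    using assms by (auto simp: invertible_def)
  \<comment> \<open>The columns of the inverse are dual to the rows of \<open>M\<close>: column
    \<open>k\<close> is orthogonal to all earlier rows but not to row \<open>k\<close>, which is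
    therefore outside their span.\<close>
  have dual: "v i \<bullet> column k N = (if i = k then 1 else 0)" for i k
    using arg_cong[OF N, of "\<lambda>A. A $ i $ k"]
    by (simp add: matrix_matrix_mult_component v_def mat_def)
  have "\<exists>q. norm q = 1 \<and> q \<in> span (v ` {..k}) \<and> (\<forall>j<k. q \<bullet> v j = 0) \<and> q \<bullet> v k > 0" for k
  proof -
    have "v k \<notin> span (v ` {..<k})"
    proof
      assume "v k \<in> span (v ` {..<k})"
      then have "orthogonal (column k N) (v k)"
        by (rule orthogonal_to_span) (auto simp: orthogonal_def dual inner_commute[of "column _ _"])
      then show False by (simp add: orthogonal_def dual inner_commute[of "column _ _"])
    qed
    moreover have "v k \<in> span (v ` {..k})" by (intro span_base) auto
    moreover have "span (v ` {..<k}) \<subseteq> span (v ` {..k})" by (intro span_mono image_mono) auto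
    ultimately have "span (v ` {..<k}) \<subset> span (v ` {..k})" by blast
    then obtain z where z: "z \<noteq> 0" "z \<in> span (v ` {..k})" "\<And>y. y \<in> span (v ` {..<k}) \<Longrightarrow> orthogonal z y"
      using orthogonal_to_subspace_exists_gen by metis
    have zj: "z \<bullet> v j = 0" if "j < k" for j
      using z(3)[of "v j"] that by (auto simp: orthogonal_def intro: span_base)
    have "z \<bullet> v k \<noteq> 0"
    proof
      assume "z \<bullet> v k = 0"
      then have "orthogonal z y" if "y \<in> v ` {..k}" for y
        using that zj by (auto simp: orthogonal_def le_less)
      then have "orthogonal z z" using z(2) orthogonal_to_span by blast
      then show False using z(1) by (simp add: orthogonal_self)
    qed
    \<comment> \<open>Dividing by the norm gives a unit vector; the sign is chosen to make the
      diagonal entry of \<open>L\<close> positive.\<close>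
    then show ?thesis
      using z(1,2) zj
      by (intro exI[of _ "(sgn (z \<bullet> v k) / norm z) *\<^sub>R z"])
        (auto simp: span_scale abs_sgn_eq sgn_if divide_simps)
  qed
  then obtain q where q: "\<And>k. norm (q k) = 1" "\<And>k. q k \<in> span (v ` {..k})"
      "\<And>j k. j < k \<Longrightarrow> q k \<bullet> v j = 0" "\<And>k. q k \<bullet> v k > 0"
    by metis
  have orth_less: "orthogonal (q k) (q j)" if "j < k" for j k
    using q(2)[of j] by (rule orthogonal_to_span) (use q(3) that in \<open>auto simp: orthogonal_def\<close>)
  define Q where "Q = (\<chi> k. q k)"
  have row_Q: "row k Q = q k" for k by (simp add: Q_def row_def vec_eq_iff)
  have "orthogonal (q i) (q j)" if "i \<noteq> j" for i j
    using that orth_less[of i j] orth_less[of j i] by (metis neqE orthogonal_commute)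
  then have Q: "orthogonal_matrix Q"
    by (simp add: orthogonal_matrix_orthonormal_rows row_Q q(1))
  define L where "L = M ** transpose Q"
  have L: "L $ i $ k = q k \<bullet> v i" for i k
    by (simp add: L_def matrix_matrix_mult_component column_transpose row_Q v_def inner_commute)
  have "lower_triangular_pos L"
    using q by (simp add: lower_triangular_pos_def L)
  moreover have "M = L ** Q"
    using Q by (simp add: L_def matrix_mul_assoc[symmetric] orthogonal_matrix)
  ultimately show thesis using that Q by blast
qed

lemma ellipsoid_lower_triangular:
  fixes K :: "(real ^ 'n::{finite,wellorder}) set"
  assumes "ellipsoid K"
  obtains L c where "lower_triangular_pos L" "K = (\<lambda>x. L *v x + c) ` cball 0 1"
proof -
  obtain M :: "real ^ 'n::_ ^ 'n::_" and c where M: "invertible M" "K = (\<lambda>x. M *v x + c) ` cball 0 1"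
    using assms unfolding ellipsoid_def by blast
  obtain L Q where LQ: "lower_triangular_pos L" "orthogonal_matrix Q" "M = L ** Q"
    using LQ_decomposition[OF M(1)] .
  have "orthogonal_transformation ((*v) Q)"
    using LQ(2) by (simp add: orthogonal_transformation_matrix)
  then have ball: "(*v) Q ` cball 0 1 = cball 0 1"
    by (simp add: image_orthogonal_transformation_cball)
  have "K = (\<lambda>x. L *v x + c) ` (*v) Q ` cball 0 1"
    unfolding M(2) LQ(3) image_image by (simp add: matrix_vector_mul_assoc)
  then show thesis using that LQ(1) ball by metis
qed

section \<open>Volume and dimension for triangular forms\<close>

lemma measure_affine_image_cball:
  fixes M :: "real ^ 'n::{finite,wellorder} ^ 'n::_"
  shows "measure lebesgue ((\<lambda>x. M *v x + c) ` cball 0 1) =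
    \<bar>det M\<bar> * measure lebesgue (cball 0 1 :: (real ^ 'n::_) set)"
proof -
  have "(\<lambda>x. M *v x + c) ` cball 0 1 = (+) c ` (*v) M ` cball 0 1"
    by (simp add: image_image add.commute)
  then show ?thesis
    by (simp add: measure_translation measure_linear_image)
qed

text \<open>The logarithm of the determinant is the sum of the logarithms of the diagonal entries,
  which are linear in the matrix, so Jensen's inequality for \<open>ln\<close> applies entry by
  entry.\<close>

lemma convex_combination_lower_triangular_pos:
  fixes L :: "'i \<Rightarrow> real ^ 'n::{finite,wellorder} ^ 'n::_"
  assumes fin: "finite A" and u: "\<And>i. i \<in> A \<Longrightarrow> 0 \<le> u i" "sum u A = 1"
    and L: "\<And>i. i \<in> A \<Longrightarrow> lower_triangular_pos (L i)" and \<delta>: "\<And>i. i \<in> A \<Longrightarrow> det (L i) = \<delta>"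
  shows "lower_triangular_pos (\<Sum>i\<in>A. u i *\<^sub>R L i)" "\<delta> \<le> det (\<Sum>i\<in>A. u i *\<^sub>R L i)"
proof -
  let ?C = "\<Sum>i\<in>A. u i *\<^sub>R L i"
  have pos: "L i $ k $ k > 0" if "i \<in> A" for i k
    using L[OF that] by (simp add: lower_triangular_pos_def)
  have C: "?C $ j $ k = (\<Sum>i\<in>A. u i * L i $ j $ k)" for j k by simp
  have "A \<noteq> {}" using u(2) by auto
  \<comment> \<open>Some weight is positive, which makes the diagonal of the combination strictly
    positive.\<close>
  obtain p where p: "p \<in> A" "u p > 0"
    using u by (metis less_eq_real_def sum.neutral zero_neq_one)
  have "?C $ k $ k > 0" for k
    unfolding C using fin p u pos
    by (intro sum_pos2[of A p]) (auto intro!: mult_nonneg_nonneg less_imp_le[OF pos])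
  moreover have "?C $ j $ k = 0" if "j < k" for j k
    unfolding C using L that by (intro sum.neutral) (auto simp: lower_triangular_pos_def)
  ultimately show lt: "lower_triangular_pos ?C" by (simp add: lower_triangular_pos_def)
  have ln_det: "ln (det T) = (\<Sum>k\<in>UNIV. ln (T $ k $ k))" if "lower_triangular_pos T" for T :: "real ^ 'n::_ ^ 'n::_"
    unfolding det_lower_triangular_pos(1)[OF that]
    by (rule ln_prod) (use that in \<open>auto simp: lower_triangular_pos_def less_le\<close>)
  have "\<delta> > 0" using \<delta> p det_lower_triangular_pos(2)[OF L] by force
  have "ln \<delta> = (\<Sum>i\<in>A. u i * ln (det (L i)))"
    using \<delta> u(2) by (simp add: sum_distrib_right[symmetric])
  also have "\<dots> = (\<Sum>i\<in>A. \<Sum>k\<in>UNIV. u i * ln (L i $ k $ k))"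
    using L by (simp add: ln_det sum_distrib_left)
  also have "\<dots> = (\<Sum>k\<in>UNIV. \<Sum>i\<in>A. u i * ln (L i $ k $ k))" by (rule sum.swap)
  also have "\<dots> \<le> (\<Sum>k\<in>UNIV. ln (\<Sum>i\<in>A. u i *\<^sub>R (L i $ k $ k)))"
    using fin \<open>A \<noteq> {}\<close> u pos
    by (intro sum_mono concave_on_sum[OF _ _ ln_concave]) auto
  also have "\<dots> = ln (det ?C)"
    using lt by (simp add: ln_det)
  finally show "\<delta> \<le> det ?C"
    using \<open>\<delta> > 0\<close> det_lower_triangular_pos(2)[OF lt] by simp
qed

text \<open>The triangle and its transpose cover the square and meet in the diagonal; doubling the
  count avoids a division.\<close>

lemma card_lower_triangle:
  "2 * card {(i, j). j \<le> (i :: 'n::{finite,linorder})} = CARD('n) * (CARD('n) + 1)"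
proof -
  let ?T = "{(i, j). j \<le> (i :: 'n)}"
  have "card {(i, j). i \<le> (j :: 'n)} = card ?T"
    by (rule bij_betw_same_card[of prod.swap]) (auto simp: bij_betw_def inj_on_def image_iff)
  moreover have "card ?T + card {(i, j). i \<le> (j :: 'n)} =
      card (?T \<union> {(i, j). i \<le> j}) + card (?T \<inter> {(i, j). i \<le> j})"
    by (rule card_Un_Int) auto
  moreover have "?T \<union> {(i, j). i \<le> j} = UNIV" by auto
  moreover have "?T \<inter> {(i, j). i \<le> j} = range (\<lambda>i. (i, i))" by auto
  moreover have "card (range (\<lambda>i :: 'n. (i, i))) = CARD('n)"
    by (rule card_image) (auto simp: inj_on_def)
  ultimately show ?thesis
    by (simp add: card_cartesian_product[of UNIV UNIV, simplified])
qed

text \<open>Matrix units on and below the diagonal, with the coordinate vectors for the centre, span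
  \<open>S\<close>; their number is n(n+1)/2 + n = n(n+3)/2.\<close>

lemma dim_lower_triangular_affine_le:
  fixes S :: "((real ^ 'n::{finite,wellorder} ^ 'n::_) \<times> (real ^ 'n::_)) set"
  assumes "\<And>L c i j. (L, c) \<in> S \<Longrightarrow> i < j \<Longrightarrow> L $ i $ j = 0"
  shows "dim S \<le> CARD('n) * (CARD('n) + 3) div 2"
proof -
  let ?T = "{(i, j). j \<le> (i :: 'n)}"
  define e :: "'n \<times> 'n \<Rightarrow> (real ^ 'n::_ ^ 'n::_) \<times> (real ^ 'n::_)" where "e = (\<lambda>(i, j). (axis i (axis j 1), 0))"
  define g :: "'n \<Rightarrow> (real ^ 'n::_ ^ 'n::_) \<times> (real ^ 'n::_)" where "g i = (0, axis i 1)" for i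
  define W where "W = e ` ?T \<union> range g"
  have "S \<subseteq> span W"
  proof clarify
    fix L c assume Lc: "(L, c) \<in> S"
    have row: "(\<Sum>j\<in>UNIV. L $ i $ j *\<^sub>R axis i (axis j 1)) = axis i (L $ i)" for i
    proof (subst vec_eq_iff, rule allI)
      fix k
      show "(\<Sum>j\<in>UNIV. L $ i $ j *\<^sub>R axis i (axis j 1)) $ k = axis i (L $ i) $ k"
        by (cases "k = i") (simp_all add: vec_eq_iff axis_def if_distrib[of "\<lambda>v. _ * v"] cong: if_cong)
    qed
    have "L = (\<Sum>i\<in>UNIV. \<Sum>j\<in>UNIV. L $ i $ j *\<^sub>R axis i (axis j 1))"
      unfolding row by (simp add: vec_eq_iff[of L] axis_def)
    moreover have "c = (\<Sum>i\<in>UNIV. c $ i *\<^sub>R axis i 1)"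
      by (simp add: vec_eq_iff axis_def if_distrib[of "\<lambda>v. _ * v"] cong: if_cong)
    ultimately have "(L, c) = (\<Sum>i\<in>UNIV. \<Sum>j\<in>UNIV. L $ i $ j *\<^sub>R e (i, j)) + (\<Sum>i\<in>UNIV. c $ i *\<^sub>R g i)"
      by (simp add: prod_eq_iff fst_sum snd_sum e_def g_def)
    also have "\<dots> \<in> span W"
    proof (intro span_add span_sum)
      fix i j
      show "L $ i $ j *\<^sub>R e (i, j) \<in> span W"
      proof (cases "j \<le> i")
        case True
        then have "e (i, j) \<in> W" by (auto simp: W_def)
        then show ?thesis by (intro span_scale span_base)
      next
        case False
        then show ?thesis using assms[OF Lc, of i j] by (simp add: span_zero)
      qed
      show "c $ i *\<^sub>R g i \<in> span W"
        by (intro span_scale span_base) (simp add: W_def)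
    qed
    finally show "(L, c) \<in> span W" .
  qed
  then have "dim S \<le> card W" by (rule dim_le_card) (simp add: W_def)
  also have "\<dots> \<le> card ?T + CARD('n)"
    unfolding W_def by (intro order_trans[OF card_Un_le] add_mono card_image_le) auto
  also have "\<dots> = CARD('n) * (CARD('n) + 3) div 2"
    using card_lower_triangle[where 'n = 'n] by (simp add: algebra_simps)
  finally show ?thesis .
qed

text \<open>One point \<open>(C, d)\<close> lies in the hulls of all parts, each with its own
  weights, so the single ellipsoid it encodes lies in the convex hull of every union.\<close>

theorem tverberg_ellipsoids_wellorder:
  fixes F :: "'i \<Rightarrow> (real ^ 'n::{finite,wellorder}) set" and J :: "'j set"
  assumes fin: "finite I" "finite J" "J \<noteq> {}"
    and card: "card I = (card J - 1) * (CARD('n) * (CARD('n) + 3) div 2 + 1) + 1"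
    and ell: "\<And>i. i \<in> I \<Longrightarrow> ellipsoid (F i)"
    and vol: "\<And>i. i \<in> I \<Longrightarrow> measure lebesgue (F i) = 1"
  obtains A K where "(\<Union>j\<in>J. A j) = I" "disjoint_family_on A J" "\<And>j. j \<in> J \<Longrightarrow> A j \<noteq> {}"
    "ellipsoid K" "measure lebesgue K = 1"
    "\<And>j. j \<in> J \<Longrightarrow> K \<subseteq> convex hull (\<Union>i\<in>A j. F i)"
proof -
  have "\<forall>i\<in>I. \<exists>L c. lower_triangular_pos L \<and> F i = (\<lambda>x. L *v x + c) ` cball 0 1"
    using ellipsoid_lower_triangular[OF ell] by metis
  then obtain L c where L: "\<And>i. i \<in> I \<Longrightarrow> lower_triangular_pos (L i)"
    and F: "\<And>i. i \<in> I \<Longrightarrow> F i = (\<lambda>x. L i *v x + c i) ` cball 0 1"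
    by metis
  \<comment> \<open>Volume one means determinant \<open>1 / \<beta>\<close>, the common value that
    the determinant bound requires.\<close>
  define \<beta> where "\<beta> = measure lebesgue (cball 0 1 :: (real ^ 'n::_) set)"
  have L\<beta>: "det (L i) * \<beta> = 1" if "i \<in> I" for i
    using vol[OF that] det_lower_triangular_pos(2)[OF L[OF that]]
    by (simp add: F[OF that] measure_affine_image_cball \<beta>_def)
  have "I \<noteq> {}" using card by auto
  then have "\<beta> \<noteq> 0" using L\<beta> by force
  moreover have "\<beta> \<ge> 0" by (simp add: \<beta>_def)
  ultimately have "\<beta> > 0" by simp
  then have det_L: "det (L i) = 1 / \<beta>" if "i \<in> I" for i
    using L\<beta>[OF that] by (simp add: field_simps)
  define x where "x i = (L i, c i)" for i
  have "dim (x ` I) \<le> CARD('n) * (CARD('n) + 3) div 2"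
    by (rule dim_lower_triangular_affine_le) (use L in \<open>auto simp: x_def lower_triangular_pos_def\<close>)
  then have "(card J - 1) * (dim (x ` I) + 1) < card I"
    unfolding card by (simp add: le_imp_less_Suc)
  then obtain A z where A: "(\<Union>j\<in>J. A j) = I" "disjoint_family_on A J"
    and z: "\<And>j. j \<in> J \<Longrightarrow> z \<in> convex hull (x ` A j)"
    using tverberg[OF fin, of x] by metis
  obtain C d where Cd: "z = (C, d)" by fastforce
  have weights: "\<exists>u. (\<forall>i\<in>A j. 0 \<le> u i) \<and> sum u (A j) = 1 \<and>
      C = (\<Sum>i\<in>A j. u i *\<^sub>R L i) \<and> d = (\<Sum>i\<in>A j. u i *\<^sub>R c i)" if "j \<in> J" for j
  proof -
    have "finite (A j)" using fin A(1) that by (metis UN_upper finite_subset)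
    then obtain u where u: "\<forall>i\<in>A j. 0 \<le> u i" "sum u (A j) = 1" "z = (\<Sum>i\<in>A j. u i *\<^sub>R x i)"
      using z[OF \<open>j \<in> J\<close>] by (auto simp: convex_hull_image_finite)
    moreover have "C = fst z" "d = snd z" by (simp_all add: Cd)
    ultimately show ?thesis
      by (intro exI[of _ u]) (simp add: fst_sum snd_sum x_def)
  qed
  have AI: "A j \<subseteq> I" "finite (A j)" if "j \<in> J" for j
    using A(1) that fin finite_subset[of "A j" I] by auto
  have C: "lower_triangular_pos C" "1 / \<beta> \<le> det C"
  proof -
    obtain j where j: "j \<in> J" using fin by blast
    then obtain u where u: "\<forall>i\<in>A j. 0 \<le> u i" "sum u (A j) = 1" "C = (\<Sum>i\<in>A j. u i *\<^sub>R L i)"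
      using weights by blast
    show "lower_triangular_pos C" "1 / \<beta> \<le> det C"
      unfolding u(3) using AI[OF j] u(1,2) L det_L
      by (auto intro!: convex_combination_lower_triangular_pos)
  qed
  have hull: "C *v y + d \<in> convex hull (\<Union>i\<in>A j. F i)" if "j \<in> J" "y \<in> cball 0 1" for j y
  proof -
    obtain u where u: "\<forall>i\<in>A j. 0 \<le> u i" "sum u (A j) = 1"
        "C = (\<Sum>i\<in>A j. u i *\<^sub>R L i)" "d = (\<Sum>i\<in>A j. u i *\<^sub>R c i)"
      using weights[OF \<open>j \<in> J\<close>] by blast
    have "C *v y = (\<Sum>i\<in>A j. u i *\<^sub>R (L i *v y))"
      unfolding u(3)
      by (simp add: vec_eq_iff matrix_vector_mult_def sum_distrib_left sum_distrib_right mult.assoc sum.swap[of _ "A j"])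
    then have "C *v y + d = (\<Sum>i\<in>A j. u i *\<^sub>R (L i *v y + c i))"
      by (simp add: u(4) scaleR_right_distrib sum.distrib)
    also have "\<dots> \<in> convex hull (\<Union>i\<in>A j. F i)"
    proof (rule convex_sum[OF AI(2)[OF \<open>j \<in> J\<close>] convex_convex_hull u(2)])
      fix i assume i: "i \<in> A j"
      then show "0 \<le> u i" using u(1) by blast
      have "L i *v y + c i \<in> F i"
        using AI(1)[OF \<open>j \<in> J\<close>] i F[of i] \<open>y \<in> cball 0 1\<close> by blast
      then show "L i *v y + c i \<in> convex hull (\<Union>i\<in>A j. F i)"
        using i by (intro hull_inc) blast
    qed
    finally show ?thesis .
  qed
  \<comment> \<open>The scaling that makes the volume of \<open>K\<close> equal to one;
    \<open>s \<le> 1\<close> because \<open>1 / \<beta> \<le> det C\<close>.\<close>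
  define s where "s = root CARD('n) (1 / (\<beta> * det C))"
  have "det C > 0" using C det_lower_triangular_pos(2) by blast
  have s: "0 < s" "s \<le> 1" "s ^ CARD('n) * det C * \<beta> = 1"
    using \<open>\<beta> > 0\<close> \<open>det C > 0\<close> C(2) by (auto simp: s_def field_simps)
  define K where "K = (\<lambda>y. (s *\<^sub>R C) *v y + d) ` cball 0 1"
  have sC: "lower_triangular_pos (s *\<^sub>R C)"
    using C(1) s(1) by (simp add: lower_triangular_pos_def)
  have "det (s *\<^sub>R C) = s ^ CARD('n) * det C"
    unfolding det_lower_triangular_pos(1)[OF sC] det_lower_triangular_pos(1)[OF C(1)]
    by (simp add: prod.distrib)
  then have "measure lebesgue K = 1"
    unfolding K_def measure_affine_image_cball \<beta>_def[symmetric] using s \<open>det C > 0\<close> by simp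
  moreover have "ellipsoid K"
    unfolding ellipsoid_def K_def using det_lower_triangular_pos(2)[OF sC]
    by (intro exI[of _ "s *\<^sub>R C"] exI[of _ d]) (simp add: invertible_det_nz)
  moreover have "K \<subseteq> convex hull (\<Union>i\<in>A j. F i)" if "j \<in> J" for j
    unfolding K_def
  proof clarify
    fix y :: "real ^ 'n::_"
    assume "y \<in> cball 0 1"
    then have "s *\<^sub>R y \<in> cball 0 1" using s by (simp add: mult_le_one)
    moreover have "(s *\<^sub>R C) *v y = C *v (s *\<^sub>R y)"
      by (simp add: vec_eq_iff matrix_vector_mult_def mult_ac)
    ultimately show "(s *\<^sub>R C) *v y + d \<in> convex hull (\<Union>i\<in>A j. F i)"
      using hull[OF that] by simp
  qed
  moreover have "A j \<noteq> {}" if "j \<in> J" for j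
    using z[OF that] by auto
  ultimately show thesis using that A by blast
qed

text \<open>Relabelling by a well-ordered index type is linear, preserves ellipsoids and their
  volumes and commutes with convex hulls, so the well-ordered case carries over.\<close>

theorem theorem4p2:
  fixes r :: nat and I :: "'i set" and F :: "'i \<Rightarrow> (real ^ 'n) set"
  assumes "r \<ge> 1"
    and "finite I"
    and "card I = (r - 1) * (CARD('n) * (CARD('n) + 3) div 2 + 1) + 1"
    and "\<And>i. i \<in> I \<Longrightarrow> ellipsoid (F i)"
    and "\<And>i. i \<in> I \<Longrightarrow> measure lebesgue (F i) = 1"
  shows "\<exists>A :: nat \<Rightarrow> 'i set.
           (\<Union>j\<in>{1..r}. A j) = I \<and>
           disjoint_family_on A {1..r} \<and>
           (\<forall>j\<in>{1..r}. A j \<noteq> {}) \<and>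
           (\<exists>K. ellipsoid K \<and> measure lebesgue K = 1 \<and>
                K \<subseteq> (\<Inter>j\<in>{1..r}. convex hull (\<Union>i\<in>A j. F i)))"
proof -
  let ?\<phi> = "Rep_well_ordered :: 'n well_ordered \<Rightarrow> 'n"
  define h where "h = relabel ?\<phi>"
  define h' where "h' = relabel (inv ?\<phi>)"
  have h'h: "h' (h v) = v" for v
    unfolding h_def h'_def by (rule relabel_inverse(2)[OF bij_Rep_well_ordered])
  have CARD: "CARD('n well_ordered) = CARD('n)"
    using bij_Rep_well_ordered by (rule bij_betw_same_card)
  obtain A K where A: "(\<Union>j\<in>{1..r}. A j) = I" "disjoint_family_on A {1..r}"
      "\<And>j. j \<in> {1..r} \<Longrightarrow> A j \<noteq> {}"
    and K: "ellipsoid K" "measure lebesgue K = 1"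
      "\<And>j. j \<in> {1..r} \<Longrightarrow> K \<subseteq> convex hull (\<Union>i\<in>A j. h ` F i)"
  proof (rule tverberg_ellipsoids_wellorder[of I "{1..r}" "\<lambda>i. h ` F i"])
    show "{1..r} \<noteq> {}" using assms(1) by simp
    show "card I = (card {1..r} - 1) * (CARD('n well_ordered) * (CARD('n well_ordered) + 3) div 2 + 1) + 1"
      using assms(3) by (simp add: CARD)
    show "ellipsoid (h ` F i)" if "i \<in> I" for i
      unfolding h_def using assms(4)[OF that] by (intro ellipsoid_relabel_image bij_Rep_well_ordered)
    show "measure lebesgue (h ` F i) = 1" if "i \<in> I" for i
      unfolding h_def using assms(4,5)[OF that]
      by (simp add: measure_relabel_image bij_Rep_well_ordered compact_ellipsoid)
  qed (use assms(2) in auto)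
  have bij': "bij (inv ?\<phi>)" using bij_Rep_well_ordered by (rule bij_imp_bij_inv)
  have "ellipsoid (h' ` K)"
    unfolding h'_def using bij' K(1) by (rule ellipsoid_relabel_image)
  moreover have "measure lebesgue (h' ` K) = 1"
    unfolding h'_def using measure_relabel_image[OF bij' compact_ellipsoid[OF K(1)]] K(2) by simp
  moreover have "h' ` K \<subseteq> (\<Inter>j\<in>{1..r}. convex hull (\<Union>i\<in>A j. F i))"
  proof (rule INT_greatest)
    fix j assume "j \<in> {1..r}"
    have "h' ` K \<subseteq> h' ` (convex hull (\<Union>i\<in>A j. h ` F i))" using K(3)[OF \<open>j \<in> {1..r}\<close>] by (rule image_mono)
    also have "\<dots> = convex hull (h' ` (\<Union>i\<in>A j. h ` F i))"
      unfolding h'_def by (rule convex_hull_linear_image[OF linear_relabel])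
    also have "h' ` (\<Union>i\<in>A j. h ` F i) = (\<Union>i\<in>A j. F i)"
      by (simp add: image_UN image_image h'h)
    finally show "h' ` K \<subseteq> convex hull (\<Union>i\<in>A j. F i)" .
  qed
  ultimately show ?thesis using A by blast
qed

end
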